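(* Let $P$ be a finite ranked poset with least and greatest elements and $\operatorname{rank}P\ge2$, and let $j\ge1$ be an integer. Then $$|\mathrm{Quilts}(P,A_2(j))|=\sum_{C}\alpha_P(C)^j,$$ where the sum is over all subsets $C$ of $P\setminus\{\hat 0_P,\hat 1_P\}$ that are convex cut sets of $P$, and $\alpha_P(C)$ is the number of antichains contained in $C$. In particular, as $j\to\infty$, $$|\mathrm{Quilts}(P,A_2(j))|\sim d_1(P)^j,$$ where $d_1(P)$ is the $1$-Dedekind number of $P$.
   Context: $\mathbb N=\{0,1,2,\dots\}$. All posets are finite, ranked (all maximal chains have the same size), and have a least element $\hat 0$ and a greatest element $\hat 1$. $x\lessdot y$ means $y$ covers $x$. The rank function satisfies $\operatorname{rank}\hat 0=0$ and $\operatorname{rank}y=\operatorname{rank}x+1$ if $x\lessdot y$; $\operatorname{rank}P=\operatorname{rank}\hat 1_P$. $P\times Q$ carries the product order. $A_2(j)$ is the poset consisting of $\hat 0$, $\hat 1$ and $j$ further pairwise incomparable elements strictly between $\hat 0$ and $\hat 1$ (so it has rank 2). $a_j\sim b_j$ means $a_j/b_j\to1$. A quilt of type $(P,Q)$ is a map $f:P\times Q\to\mathbb N$ such that: (i) $f(x,y)=0$ whenever $x=\hat 0_P$ or $y=\hat 0_Q$; (ii) $f(\hat 1_P,\hat 1_Q)=\min\{\operatorname{rank}P,\operatorname{rank}Q\}$; (iii) if $(x,y)\lessdot(x',y')$ in $P\times Q$, then $f(x',y')\in\{f(x,y),f(x,y)+1\}$. $\mathrm{Quilts}(P,Q)$ is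 the set of all quilts of type $(P,Q)$. A subset $S\subseteq P$ is convex if $x,y\in S$, $x\le y$, implies $[x,y]\subseteq S$. It is a cut set if it intersects every maximal chain of $P$. An antichain is a set of pairwise incomparable elements (the empty set counts as an antichain). $d_1(P)$ is the number of surjective maps $f:P\to\{0,1\}$ with $f(y)\in\{f(x),f(x)+1\}$ whenever $x\lessdot y$. *)

theory Defs
  imports Complex_Main "HOL-Library.FuncSet" "HOL-Library.Landau_Symbols"
begin

text \<open>
  A poset is a reflexive order relation \<open>P :: 'a rel\<close>; its underlying set is \<open>Field P\<close>.
\<close>

definition least_element :: "'a rel \<Rightarrow> 'a \<Rightarrow> bool" where
  "least_element P z \<longleftrightarrow> z \<in> Field P \<and> (\<forall>x\<in>Field P. (z, x) \<in> P)"

definition greatest_element :: "'a rel \<Rightarrow> 'a \<Rightarrow> bool" where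
  "greatest_element P z \<longleftrightarrow> z \<in> Field P \<and> (\<forall>x\<in>Field P. (x, z) \<in> P)"

definition poset_bot :: "'a rel \<Rightarrow> 'a" where
  "poset_bot P = (THE z. least_element P z)"

definition poset_top :: "'a rel \<Rightarrow> 'a" where
  "poset_top P = (THE z. greatest_element P z)"

definition covers :: "'a rel \<Rightarrow> 'a \<Rightarrow> 'a \<Rightarrow> bool" where
  \<comment> \<open>\<open>covers P x y\<close> reads: \<open>y\<close> covers \<open>x\<close>\<close>
  "covers P x y \<longleftrightarrow> (x, y) \<in> P \<and> x \<noteq> y \<and> (\<forall>z. (x, z) \<in> P \<and> (z, y) \<in> P \<longrightarrow> z = x \<or> z = y)"

definition maximal_chain :: "'a rel \<Rightarrow> 'a set \<Rightarrow> bool" where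
  "maximal_chain P C \<longleftrightarrow> C \<in> Chains P \<and> (\<forall>D\<in>Chains P. C \<subseteq> D \<longrightarrow> D = C)"

definition ranked_poset :: "'a rel \<Rightarrow> bool" where
  "ranked_poset P \<longleftrightarrow>
     Partial_order P \<and> finite (Field P) \<and>
     (\<exists>z. least_element P z) \<and> (\<exists>z. greatest_element P z) \<and>
     (\<forall>C D. maximal_chain P C \<longrightarrow> maximal_chain P D \<longrightarrow> card C = card D)"

definition rank_function :: "'a rel \<Rightarrow> ('a \<Rightarrow> nat) \<Rightarrow> bool" where
  "rank_function P \<rho> \<longleftrightarrow> \<rho> (poset_bot P) = 0 \<and> (\<forall>x y. covers P x y \<longrightarrow> \<rho> y = \<rho> x + 1)"

text \<open>
  On a ranked poset a rank function exists and is unique on \<open>Field P\<close>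
  (lemmas \<open>rank_function_exists\<close> and \<open>rank_function_unique\<close> below).
\<close>

definition poset_rank :: "'a rel \<Rightarrow> nat" where
  "poset_rank P = (SOME \<rho>. rank_function P \<rho>) (poset_top P)"

definition prod_order :: "'a rel \<Rightarrow> 'b rel \<Rightarrow> ('a \<times> 'b) rel" where
  "prod_order P Q = {((x, y), (x', y')). (x, x') \<in> P \<and> (y, y') \<in> Q}"

datatype A2_elem = Bot | Mid nat | Top

definition A2 :: "nat \<Rightarrow> A2_elem rel" where
  "A2 j = (let V = {Bot, Top} \<union> Mid ` {..<j} in {(x, y) \<in> V \<times> V. x = y \<or> x = Bot \<or> y = Top})"

text \<open>
  Functions on a poset are taken to be \<open>undefined\<close> outside its underlying set,
  so that counting them is meaningful.
\<close>

definition Quilts :: "'a rel \<Rightarrow> 'b rel \<Rightarrow> ('a \<times> 'b \<Rightarrow> nat) set" where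
  "Quilts P Q =
     {f \<in> Field P \<times> Field Q \<rightarrow>\<^sub>E UNIV.
        (\<forall>x\<in>Field P. \<forall>y\<in>Field Q. x = poset_bot P \<or> y = poset_bot Q \<longrightarrow> f (x, y) = 0) \<and>
        f (poset_top P, poset_top Q) = min (poset_rank P) (poset_rank Q) \<and>
        (\<forall>p q. covers (prod_order P Q) p q \<longrightarrow> f q \<in> {f p, f p + 1})}"

definition convex_in :: "'a rel \<Rightarrow> 'a set \<Rightarrow> bool" where
  "convex_in P S \<longleftrightarrow> S \<subseteq> Field P \<and>
     (\<forall>x\<in>S. \<forall>y\<in>S. (x, y) \<in> P \<longrightarrow> {z. (x, z) \<in> P \<and> (z, y) \<in> P} \<subseteq> S)"

definition cut_set :: "'a rel \<Rightarrow> 'a set \<Rightarrow> bool" where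
  "cut_set P S \<longleftrightarrow> S \<subseteq> Field P \<and> (\<forall>C. maximal_chain P C \<longrightarrow> S \<inter> C \<noteq> {})"

definition antichain_in :: "'a rel \<Rightarrow> 'a set \<Rightarrow> bool" where
  "antichain_in P A \<longleftrightarrow> A \<subseteq> Field P \<and> (\<forall>x\<in>A. \<forall>y\<in>A. x \<noteq> y \<longrightarrow> (x, y) \<notin> P)"

definition num_antichains :: "'a rel \<Rightarrow> 'a set \<Rightarrow> nat" where
  "num_antichains P C = card {A. A \<subseteq> C \<and> antichain_in P A}"

definition dedekind1 :: "'a rel \<Rightarrow> nat" where
  "dedekind1 P =
     card {f \<in> Field P \<rightarrow>\<^sub>E {0, 1::nat}. f ` Field P = {0, 1} \<and>
             (\<forall>x y. covers P x y \<longrightarrow> f y \<in> {f x, f x + 1})}"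

lemma ranked_posetD:
  assumes "ranked_poset P"
  shows "\<And>x y. (x, y) \<in> P \<Longrightarrow> x \<in> Field P" "\<And>x y. (x, y) \<in> P \<Longrightarrow> y \<in> Field P"
    and "\<And>x. x \<in> Field P \<Longrightarrow> (x, x) \<in> P"
    and "\<And>x y z. (x, y) \<in> P \<Longrightarrow> (y, z) \<in> P \<Longrightarrow> (x, z) \<in> P"
    and "\<And>x y. (x, y) \<in> P \<Longrightarrow> (y, x) \<in> P \<Longrightarrow> x = y"
    and "finite (Field P)"
proof -
  have "refl_on (Field P) P" "trans P" "antisym P" and fin: "finite (Field P)"
    using assms by (auto simp: ranked_poset_def order_on_defs)
  then show "\<And>x y. (x, y) \<in> P \<Longrightarrow> x \<in> Field P" "\<And>x y. (x, y) \<in> P \<Longrightarrow> y \<in> Field P"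
    "\<And>x. x \<in> Field P \<Longrightarrow> (x, x) \<in> P"
    "\<And>x y z. (x, y) \<in> P \<Longrightarrow> (y, z) \<in> P \<Longrightarrow> (x, z) \<in> P"
    "\<And>x y. (x, y) \<in> P \<Longrightarrow> (y, x) \<in> P \<Longrightarrow> x = y" "finite (Field P)"
    by (auto simp: Field_def refl_on_def dest: transD antisymD)
qed

lemma least_element_poset_bot:
  assumes "ranked_poset P"
  shows "least_element P (poset_bot P)"
proof -
  obtain z where z: "least_element P z" using assms by (auto simp: ranked_poset_def)
  have "z' = z" if "least_element P z'" for z'
    using that z ranked_posetD(5)[OF assms] by (auto simp: least_element_def)
  with z show ?thesis unfolding poset_bot_def by (rule theI)
qed

lemma greatest_element_poset_top:
  assumes "ranked_poset P"
  shows "greatest_element P (poset_top P)"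
proof -
  obtain z where z: "greatest_element P z" using assms by (auto simp: ranked_poset_def)
  have "z' = z" if "greatest_element P z'" for z'
    using that z ranked_posetD(5)[OF assms] by (auto simp: greatest_element_def)
  with z show ?thesis unfolding poset_top_def by (rule theI)
qed

lemma rank_function_exists:
  assumes P: "ranked_poset P"
  shows "\<exists>\<rho>. rank_function P \<rho>"
proof -
  note D = ranked_posetD[OF P]
  define dn where "dn x = {C \<in> Chains P. C \<subseteq> {z. (z, x) \<in> P}}" for x
  define up where "up x = {C \<in> Chains P. C \<subseteq> {z. (x, z) \<in> P}}" for x
  define \<rho> where "\<rho> x = Max (card ` dn x) - 1" for x
  have fdn: "finite (dn x)" and fup: "finite (up x)" for x
    by (rule finite_subset[of _ "Pow (Field P)"], auto simp: dn_def up_def D(6) dest: D(1,2))+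
  have fC: "finite C" if "C \<in> Chains P" for C
    using that D(1,6) by (intro finite_subset[of C "Field P"]) (auto simp: Chains_def)
  have ne: "{} \<in> dn x" "{} \<in> up x" for x by (auto simp: dn_def up_def Chains_def)
  have mdn: "\<exists>C\<in>dn x. card C = Max (card ` dn x) \<and> x \<in> C" if x: "x \<in> Field P" for x
  proof -
    have "Max (card ` dn x) \<in> card ` dn x" using fdn ne by (intro Max_in) auto
    then obtain C where C: "C \<in> dn x" "card C = Max (card ` dn x)" by auto
    have "insert x C \<in> dn x" using C(1) D(3)[OF x] by (auto simp: dn_def Chains_def)
    then have "card (insert x C) \<le> card C" unfolding C(2) using fdn by (intro Max_ge) auto
    then have "x \<in> C" using fC C(1) by (cases "x \<in> C") (auto simp: dn_def)
    with C show ?thesis by auto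
  qed
  have mup: "\<exists>C\<in>up x. card C = Max (card ` up x) \<and> x \<in> C" if x: "x \<in> Field P" for x
  proof -
    have "Max (card ` up x) \<in> card ` up x" using fup ne by (intro Max_in) auto
    then obtain C where C: "C \<in> up x" "card C = Max (card ` up x)" by auto
    have "insert x C \<in> up x" using C(1) D(3)[OF x] by (auto simp: up_def Chains_def)
    then have "card (insert x C) \<le> card C" unfolding C(2) using fup by (intro Max_ge) auto
    then have "x \<in> C" using fC C(1) by (cases "x \<in> C") (auto simp: up_def)
    with C show ?thesis by auto
  qed
  have cov: "\<rho> y = \<rho> x + 1" if c: "covers P x y" for x y
  proof -
    have xy: "(x, y) \<in> P" "x \<noteq> y" and btw: "\<And>z. (x, z) \<in> P \<Longrightarrow> (z, y) \<in> P \<Longrightarrow> z = x \<or> z = y"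
      using c by (auto simp: covers_def)
    then have F: "x \<in> Field P" "y \<in> Field P" using D(1,2) by blast+
    obtain C where C: "C \<in> dn x" "card C = Max (card ` dn x)" "x \<in> C" using mdn F by blast
    obtain E where E: "E \<in> dn y" "card E = Max (card ` dn y)" "y \<in> E" using mdn F by blast
    obtain U where U: "U \<in> up y" "card U = Max (card ` up y)" "y \<in> U" using mup F by blast
    have fin: "finite C" "finite E" "finite U" using C E U fC by (auto simp: dn_def up_def)
    have ch: "C \<union> U \<in> Chains P" "E \<union> U \<in> Chains P"
    proof -
      have CP: "C \<in> Chains P" "E \<in> Chains P" "U \<in> Chains P"
        using C(1) E(1) U(1) by (auto simp: dn_def up_def)
      have CU: "(a, b) \<in> P" if "a \<in> C" "b \<in> U" for a b
      proof -
        have "(a, x) \<in> P" "(y, b) \<in> P" using that C(1) U(1) by (auto simp: dn_def up_def)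
        with xy(1) D(4) show ?thesis by metis
      qed
      have EU: "(a, b) \<in> P" if "a \<in> E" "b \<in> U" for a b
      proof -
        have "(a, y) \<in> P" "(y, b) \<in> P" using that E(1) U(1) by (auto simp: dn_def up_def)
        with D(4) show ?thesis by metis
      qed
      show "C \<union> U \<in> Chains P" "E \<union> U \<in> Chains P"
        using CP CU EU unfolding Chains_def by auto
    qed
    have low: "z \<in> C" if "insert z C \<in> Chains P" "(z, x) \<in> P" for z
    proof (rule ccontr)
      assume "z \<notin> C"
      have "insert z C \<in> dn x" using that C(1) by (auto simp: dn_def)
      then have "card (insert z C) \<le> card C" unfolding C(2) using fdn by (intro Max_ge) auto
      with \<open>z \<notin> C\<close> fin show False by simp
    qed
    have lowE: "z \<in> E" if "insert z E \<in> Chains P" "(z, y) \<in> P" for z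
    proof (rule ccontr)
      assume "z \<notin> E"
      have "insert z E \<in> dn y" using that E(1) by (auto simp: dn_def)
      then have "card (insert z E) \<le> card E" unfolding E(2) using fdn by (intro Max_ge) auto
      with \<open>z \<notin> E\<close> fin show False by simp
    qed
    have high: "z \<in> U" if "insert z U \<in> Chains P" "(y, z) \<in> P" for z
    proof (rule ccontr)
      assume "z \<notin> U"
      have "insert z U \<in> up y" using that U(1) by (auto simp: up_def)
      then have "card (insert z U) \<le> card U" unfolding U(2) using fup by (intro Max_ge) auto
      with \<open>z \<notin> U\<close> fin show False by simp
    qed
    have "maximal_chain P (C \<union> U)" unfolding maximal_chain_def
    proof (intro conjI ballI impI)
      show "C \<union> U \<in> Chains P" by (fact ch)
      fix M assume M: "M \<in> Chains P" "C \<union> U \<subseteq> M"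
      have "z \<in> C \<union> U" if z: "z \<in> M" for z
      proof -
        have i: "insert z C \<in> Chains P" "insert z U \<in> Chains P"
          using M z unfolding Chains_def by blast+
        have "x \<in> M" "y \<in> M" using C U M by auto
        then have "(z, x) \<in> P \<or> (x, z) \<in> P" "(z, y) \<in> P \<or> (y, z) \<in> P"
          using M z unfolding Chains_def by blast+
        then show ?thesis using low[OF i(1)] high[OF i(2)] btw[of z] C(3) U(3) by blast
      qed
      with M show "M = C \<union> U" by blast
    qed
    moreover have "maximal_chain P (E \<union> U)" unfolding maximal_chain_def
    proof (intro conjI ballI impI)
      show "E \<union> U \<in> Chains P" by (fact ch)
      fix M assume M: "M \<in> Chains P" "E \<union> U \<subseteq> M"
      have "z \<in> E \<union> U" if z: "z \<in> M" for z
      proof -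
        have i: "insert z E \<in> Chains P" "insert z U \<in> Chains P"
          using M z unfolding Chains_def by blast+
        have "y \<in> M" using U M by auto
        then have "(z, y) \<in> P \<or> (y, z) \<in> P"
          using M z unfolding Chains_def by blast+
        then show ?thesis using lowE[OF i(1)] high[OF i(2)] by blast
      qed
      with M show "M = E \<union> U" by blast
    qed
    ultimately have eq: "card (C \<union> U) = card (E \<union> U)" using P unfolding ranked_poset_def by blast
    have CU: "C \<inter> U = {}"
    proof -
      have False if "z \<in> C" "z \<in> U" for z
      proof -
        have "(z, x) \<in> P" "(y, z) \<in> P" using that C(1) U(1) by (auto simp: dn_def up_def)
        with D(4) have "(y, x) \<in> P" by metis
        with xy D(5) show False by metis
      qed
      then show ?thesis by blast
    qed
    have EU: "E \<inter> U = {y}"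
    proof -
      have "z = y" if "z \<in> E" "z \<in> U" for z
      proof -
        have "(z, y) \<in> P" "(y, z) \<in> P" using that E(1) U(1) by (auto simp: dn_def up_def)
        with D(5) show ?thesis by metis
      qed
      with E(3) U(3) show ?thesis by blast
    qed
    have "card C + card U = card E + card U - 1" "card E \<ge> 1" "card C \<ge> 1"
    proof -
      have "card C + card U = card (C \<union> U)" using card_Un_Int[OF fin(1,3)] CU by simp
      moreover have "card E + card U = card (E \<union> U) + 1" using card_Un_Int[OF fin(2,3)] EU by simp
      ultimately show "card C + card U = card E + card U - 1" using eq by linarith
      show "card E \<ge> 1" "card C \<ge> 1"
        using C(3) E(3) fin card_gt_0_iff[of C] card_gt_0_iff[of E] by (auto simp: Suc_le_eq)
    qed
    then show ?thesis unfolding \<rho>_def C(2)[symmetric] E(2)[symmetric] by linarith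
  qed
  have bot: "\<rho> (poset_bot P) = 0"
  proof -
    note b = least_element_poset_bot[OF P, unfolded least_element_def]
    obtain C where C: "C \<in> dn (poset_bot P)" "card C = Max (card ` dn (poset_bot P))"
      "poset_bot P \<in> C" using mdn b by blast
    have "z = poset_bot P" if "z \<in> C" for z
    proof -
      have "(z, poset_bot P) \<in> P" using that C(1) by (auto simp: dn_def)
      moreover from this have "(poset_bot P, z) \<in> P" using b D(1) by metis
      ultimately show ?thesis using D(5) by metis
    qed
    with C(3) have "C = {poset_bot P}" by blast
    with C show ?thesis by (simp add: \<rho>_def)
  qed
  from bot cov show ?thesis unfolding rank_function_def by blast
qed

lemma rank_function_unique:
  assumes P: "ranked_poset P" and r: "rank_function P \<rho>" "rank_function P \<sigma>" and "x \<in> Field P"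
  shows "\<rho> x = \<sigma> x"
  using \<open>x \<in> Field P\<close>
proof (induction "card {z. (z, x) \<in> P}" arbitrary: x rule: less_induct)
  case less
  note D = ranked_posetD[OF P]
  note b = least_element_poset_bot[OF P, unfolded least_element_def]
  have fin: "finite {z. (z, w) \<in> P}" for w using D by (auto intro: finite_subset[OF _ D(6)])
  have mono: "card {z. (z, v) \<in> P} < card {z. (z, w) \<in> P}" if "(v, w) \<in> P" "v \<noteq> w" for v w
  proof (rule psubset_card_mono[OF fin])
    have "{z. (z, v) \<in> P} \<subseteq> {z. (z, w) \<in> P}" using that(1) D(4) by blast
    moreover have "(w, w) \<in> P" "(w, v) \<notin> P" using that D(2,3,5) by metis+
    ultimately show "{z. (z, v) \<in> P} \<subset> {z. (z, w) \<in> P}" by blast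
  qed
  show ?case
  proof (cases "x = poset_bot P")
    case True
    then show ?thesis using r by (simp add: rank_function_def)
  next
    case False
    let ?B = "\<lambda>w. (w, x) \<in> P \<and> w \<noteq> x"
    have "?B (poset_bot P)" using b less.prems False by blast
    then obtain w where w: "?B w"
      and m: "\<And>v. ?B v \<Longrightarrow> card {z. (z, v) \<in> P} \<le> card {z. (z, w) \<in> P}"
      using ex_has_greatest_nat[of ?B "poset_bot P" "\<lambda>v. card {z. (z, v) \<in> P}"
          "card {z. (z, x) \<in> P} + 1"] mono by (metis less_SucI Suc_eq_plus1)
    have "covers P w x" unfolding covers_def using w m mono by (metis not_le)
    moreover have "\<rho> w = \<sigma> w" using less.hyps[of w] w mono D(1) by blast
    ultimately show ?thesis using r by (simp add: rank_function_def)
  qed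
qed

end

theory Submission
  imports Defs
begin

text \<open>
  Restricting a quilt \<open>f\<close> to the three levels of \<open>A2 j\<close> gives the zero function at the bottom,
  indicators \<open>g i\<close> of up-sets at the \<open>j\<close> middle elements, and a function \<open>h\<close> at the top that climbs
  from 0 to 2 in unit steps. Such an \<open>h\<close> is determined by its level set \<open>C = {h = 1}\<close>, and the level
  sets that occur are the convex cut sets avoiding the two extreme elements. The condition
  \<open>h \<in> {g i, g i + 1}\<close> forces \<open>g i\<close> off \<open>C\<close> and leaves an arbitrary up-set of \<open>C\<close>, equivalently
  an antichain of \<open>C\<close>, free on \<open>C\<close>.

  For the asymptotics, \<open>C = P - {0, 1}\<close> contributes \<open>d\<^sub>1(P)\<^sup>j\<close>; every other \<open>C\<close> misses a one-element
  antichain, so its contribution is exponentially smaller.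
\<close>

section \<open>Ranked posets\<close>

lemma poset_bot:
  assumes "ranked_poset P"
  shows "poset_bot P \<in> Field P" "\<And>x. x \<in> Field P \<Longrightarrow> (poset_bot P, x) \<in> P"
  using least_element_poset_bot[OF assms] by (auto simp: least_element_def)

lemma poset_top:
  assumes "ranked_poset P"
  shows "poset_top P \<in> Field P" "\<And>x. x \<in> Field P \<Longrightarrow> (x, poset_top P) \<in> P"
  using greatest_element_poset_top[OF assms] by (auto simp: greatest_element_def)

lemma Chains_subset_Field:
  assumes "M \<in> Chains P"
  shows "M \<subseteq> Field P"
  using assms by (auto simp: Chains_def Field_def)

lemma minimal_element_exists:
  assumes P: "ranked_poset P" and S: "S \<subseteq> Field P" "S \<noteq> {}"
  shows "\<exists>m\<in>S. \<forall>z\<in>S. (z, m) \<in> P \<longrightarrow> z = m"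
proof -
  note D = ranked_posetD[OF P]
  have "finite S" using S D(6) finite_subset by blast
  moreover have "asymp_on S (\<lambda>x y. (x, y) \<in> P \<and> x \<noteq> y)"
    by (intro asymp_onI) (metis D(5))
  moreover have "transp_on S (\<lambda>x y. (x, y) \<in> P \<and> x \<noteq> y)"
    by (intro transp_onI) (metis D(4,5))
  ultimately show ?thesis
    using Finite_Set.bex_min_element[of S "\<lambda>x y. (x, y) \<in> P \<and> x \<noteq> y"] S(2) by blast
qed

lemma maximal_element_exists:
  assumes P: "ranked_poset P" and S: "S \<subseteq> Field P" "S \<noteq> {}"
  shows "\<exists>m\<in>S. \<forall>z\<in>S. (m, z) \<in> P \<longrightarrow> z = m"
proof -
  note D = ranked_posetD[OF P]
  have "finite S" using S D(6) finite_subset by blast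
  moreover have "asymp_on S (\<lambda>x y. (x, y) \<in> P \<and> x \<noteq> y)"
    by (intro asymp_onI) (metis D(5))
  moreover have "transp_on S (\<lambda>x y. (x, y) \<in> P \<and> x \<noteq> y)"
    by (intro transp_onI) (metis D(4,5))
  ultimately show ?thesis
    using Finite_Set.bex_max_element[of S "\<lambda>x y. (x, y) \<in> P \<and> x \<noteq> y"] S(2) by blast
qed

text \<open>Induction on the size of the interval from \<open>x\<close> to \<open>y\<close>. If
  \<open>y\<close> is neither equal to \<open>x\<close> nor a cover of it, some \<open>z\<close>
  lies strictly between, and both intervals cut off by \<open>z\<close> are strictly
  smaller.\<close>

lemma mono_if_mono_on_covers:
  fixes g :: "'a \<Rightarrow> nat"
  assumes P: "ranked_poset P" and g: "\<And>x y. covers P x y \<Longrightarrow> g x \<le> g y" and "(x, y) \<in> P"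
  shows "g x \<le> g y"
  using \<open>(x, y) \<in> P\<close>
proof (induction "card {z. (x, z) \<in> P \<and> (z, y) \<in> P}" arbitrary: x y rule: less_induct)
  case less
  note D = ranked_posetD[OF P]
  have fin: "finite {z. (x, z) \<in> P \<and> (z, y) \<in> P}"
    using D(1) by (auto intro: finite_subset[OF _ D(6)])
  show ?case
  proof (cases "x = y \<or> covers P x y")
    case True
    then show ?thesis using g by auto
  next
    case False
    then obtain z where z: "(x, z) \<in> P" "(z, y) \<in> P" "z \<noteq> x" "z \<noteq> y"
      using less.prems by (auto simp: covers_def)
    have "(x, x) \<in> P" "(y, y) \<in> P" using z D(1-3) by blast+
    moreover have "(z, x) \<notin> P" "(y, z) \<notin> P" using z D(5) by blast+
    ultimately have sub: "{w. (x, w) \<in> P \<and> (w, z) \<in> P} \<subset> {w. (x, w) \<in> P \<and> (w, y) \<in> P}"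
      "{w. (z, w) \<in> P \<and> (w, y) \<in> P} \<subset> {w. (x, w) \<in> P \<and> (w, y) \<in> P}"
      using z less.prems D(4) by blast+
    have "g x \<le> g z" by (rule less.hyps[OF psubset_card_mono[OF fin sub(1)] z(1)])
    also have "g z \<le> g y" by (rule less.hyps[OF psubset_card_mono[OF fin sub(2)] z(2)])
    finally show ?thesis .
  qed
qed

lemma mono_if_unit_steps:
  fixes g :: "'a \<Rightarrow> nat"
  assumes P: "ranked_poset P" and g: "\<And>x y. covers P x y \<Longrightarrow> g y \<in> {g x, g x + 1}"
    and "(x, y) \<in> P"
  shows "g x \<le> g y"
proof (rule mono_if_mono_on_covers[OF P _ \<open>(x, y) \<in> P\<close>])
  show "g x \<le> g y" if "covers P x y" for x y using g[OF that] by auto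
qed

text \<open>Cut sets are tested on maximal chains only. This allows the test to be applied through
  any prescribed point or comparable pair.\<close>

lemma chain_extends_to_maximal:
  assumes P: "ranked_poset P" and D: "D \<in> Chains P"
  shows "\<exists>M. maximal_chain P M \<and> D \<subseteq> M"
proof -
  have "finite {M \<in> Chains P. D \<subseteq> M}"
    by (rule finite_subset[of _ "Pow (Field P)"])
      (use Chains_subset_Field ranked_posetD(6)[OF P] in auto)
  from finite_has_maximal2[OF this, of D] D
  obtain M where M: "M \<in> Chains P" "D \<subseteq> M"
    and max: "\<forall>N\<in>{M \<in> Chains P. D \<subseteq> M}. M \<subseteq> N \<longrightarrow> M = N"
    by auto
  have "N = M" if "N \<in> Chains P" "M \<subseteq> N" for N
    using max that M(2) by (metis (mono_tags, lifting) mem_Collect_eq subset_trans)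
  then have "maximal_chain P M" using M(1) by (simp add: maximal_chain_def)
  then show ?thesis using M(2) by blast
qed

lemma mem_maximal_chainI:
  assumes P: "ranked_poset P" and M: "maximal_chain P M"
    and z: "z \<in> Field P" "\<And>w. w \<in> M \<Longrightarrow> (w, z) \<in> P \<or> (z, w) \<in> P"
  shows "z \<in> M"
proof -
  have "insert z M \<in> Chains P"
    using M z ranked_posetD(3)[OF P] by (auto simp: maximal_chain_def Chains_def)
  then show ?thesis using M unfolding maximal_chain_def by blast
qed

text \<open>The smallest element \<open>y\<close> of \<open>M\<close> above \<open>x\<close> works:
  an element between \<open>x\<close> and \<open>y\<close> is comparable to all of \<open>M\<close>,
  hence belongs to \<open>M\<close> by maximality and cannot lie strictly between.\<close>

lemma maximal_chain_step:
  assumes P: "ranked_poset P" and M: "maximal_chain P M" and x: "x \<in> M" "x \<noteq> poset_top P"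
  shows "\<exists>y\<in>M. covers P x y"
proof -
  note D = ranked_posetD[OF P]
  have ch: "M \<in> Chains P" using M by (simp add: maximal_chain_def)
  note MF = Chains_subset_Field[OF ch]
  have cmp: "(v, w) \<in> P \<or> (w, v) \<in> P" if "v \<in> M" "w \<in> M" for v w
    using ch that by (auto simp: Chains_def)
  let ?S = "{y \<in> M. (x, y) \<in> P \<and> y \<noteq> x}"
  have "poset_top P \<in> M"
    using mem_maximal_chainI[OF P M] poset_top[OF P] MF by blast
  then have "?S \<noteq> {}" using x poset_top[OF P] MF by blast
  then obtain y where y: "y \<in> ?S" and ymin: "\<And>z. z \<in> ?S \<Longrightarrow> (z, y) \<in> P \<Longrightarrow> z = y"
    using minimal_element_exists[OF P, of ?S] MF by blast
  have "z = x \<or> z = y" if z: "(x, z) \<in> P" "(z, y) \<in> P" for z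
  proof -
    \<comment> \<open>An element of the chain strictly above \<open>x\<close> lies in
      \<open>?S\<close>; it is comparable to \<open>y\<close>, so minimality of \<open>y\<close>
      puts it at or above \<open>y\<close>.\<close>
    have "(w, x) \<in> P \<or> (y, w) \<in> P" if "w \<in> M" for w
      using cmp[OF that x(1)] cmp[OF that, of y] ymin[of w] y that D(3) MF by blast
    then have "z \<in> M" using mem_maximal_chainI[OF P M D(2)[OF z(1)]] z D(4) by blast
    then show ?thesis using ymin[of z] z by blast
  qed
  then show ?thesis using y unfolding covers_def by blast
qed

section \<open>Antichains and up-sets\<close>

definition upsets_in :: "'a rel \<Rightarrow> 'a set \<Rightarrow> 'a set set" where
  "upsets_in P C = {U. U \<subseteq> C \<and> (\<forall>x\<in>U. \<forall>y\<in>C. (x, y) \<in> P \<longrightarrow> y \<in> U)}"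

text \<open>The classical bijection: an antichain generates an up-set, and an up-set is recovered
  from its minimal elements because, by finiteness, each of its elements lies above a minimal
  one.\<close>

lemma num_antichains_eq_card_upsets:
  assumes P: "ranked_poset P" and C: "C \<subseteq> Field P"
  shows "num_antichains P C = card (upsets_in P C)"
proof -
  note D = ranked_posetD[OF P]
  define up where "up A = {y \<in> C. \<exists>a\<in>A. (a, y) \<in> P}" for A
  define mins where "mins U = {x \<in> U. \<forall>z\<in>U. (z, x) \<in> P \<longrightarrow> z = x}" for U
  have "bij_betw up {A. A \<subseteq> C \<and> antichain_in P A} (upsets_in P C)"
  proof (rule bij_betw_byWitness[where f' = mins])
    show "\<forall>A\<in>{A. A \<subseteq> C \<and> antichain_in P A}. mins (up A) = A"
    proof
      fix A assume "A \<in> {A. A \<subseteq> C \<and> antichain_in P A}"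
      then have A: "A \<subseteq> C" "\<And>x y. x \<in> A \<Longrightarrow> y \<in> A \<Longrightarrow> (x, y) \<in> P \<Longrightarrow> x = y"
        by (auto simp: antichain_in_def)
      have sub: "A \<subseteq> up A" using A(1) C D(3) unfolding up_def by blast
      show "mins (up A) = A"
      proof
        show "mins (up A) \<subseteq> A" using sub by (fastforce simp: mins_def up_def)
        show "A \<subseteq> mins (up A)"
        proof
          fix x assume x: "x \<in> A"
          have "z = x" if z: "z \<in> up A" "(z, x) \<in> P" for z
          proof -
            \<comment> \<open>The generator \<open>a\<close> below \<open>z\<close> is also below
              \<open>x\<close>; as both lie in the antichain they coincide, which squeezes
              \<open>z\<close> to \<open>x\<close>.\<close>
            obtain a where a: "a \<in> A" "(a, z) \<in> P" using z(1) by (auto simp: up_def)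
            then have "a = x" using A(2) x z(2) D(4) by blast
            then show ?thesis using a z D(5) by blast
          qed
          then show "x \<in> mins (up A)" using x sub by (auto simp: mins_def)
        qed
      qed
    qed
    show "\<forall>U\<in>upsets_in P C. up (mins U) = U"
    proof
      fix U assume U: "U \<in> upsets_in P C"
      show "up (mins U) = U"
      proof
        show "up (mins U) \<subseteq> U" using U by (auto simp: up_def mins_def upsets_in_def)
        show "U \<subseteq> up (mins U)"
        proof
          fix x assume x: "x \<in> U"
          then have xC: "x \<in> C" "x \<in> Field P" using U C by (auto simp: upsets_in_def)
          let ?S = "{z \<in> U. (z, x) \<in> P}"
          have "x \<in> ?S" using x xC D(3) by blast
          then obtain m where m: "m \<in> ?S" "\<And>z. z \<in> ?S \<Longrightarrow> (z, m) \<in> P \<Longrightarrow> z = m"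
            using minimal_element_exists[OF P, of ?S] D(1) by blast
          \<comment> \<open>Minimality among the elements below \<open>x\<close> is minimality in
            all of \<open>U\<close>, since anything below \<open>m\<close> is again below
            \<open>x\<close>.\<close>
          have "m \<in> mins U" unfolding mins_def using m D(4) by blast
          then show "x \<in> up (mins U)" using m xC by (auto simp: up_def)
        qed
      qed
    qed
    show "up ` {A. A \<subseteq> C \<and> antichain_in P A} \<subseteq> upsets_in P C"
      using D(4) by (fastforce simp: up_def upsets_in_def)
    show "mins ` upsets_in P C \<subseteq> {A. A \<subseteq> C \<and> antichain_in P A}"
      using C by (fastforce simp: mins_def upsets_in_def antichain_in_def)
  qed
  then show ?thesis unfolding num_antichains_def by (rule bij_betw_same_card)
qed

text \<open>A singleton from \<open>E - C\<close> is an antichain that \<open>C\<close> misses.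
  Strictness makes the full interior the only dominant term in the asymptotics.\<close>

lemma num_antichains_strict_mono:
  assumes P: "ranked_poset P" and C: "C \<subset> E" "E \<subseteq> Field P"
  shows "num_antichains P C < num_antichains P E"
proof -
  have "finite E" using C(2) ranked_posetD(6)[OF P] by (rule finite_subset)
  then have fin: "finite {A. A \<subseteq> E \<and> antichain_in P A}" by simp
  obtain e where e: "e \<in> E" "e \<notin> C" using C(1) by blast
  then have "antichain_in P {e}" using C(2) by (auto simp: antichain_in_def)
  then have "{e} \<in> {A. A \<subseteq> E \<and> antichain_in P A}" "{e} \<notin> {A. A \<subseteq> C \<and> antichain_in P A}"
    using e by auto
  moreover have "{A. A \<subseteq> C \<and> antichain_in P A} \<subseteq> {A. A \<subseteq> E \<and> antichain_in P A}"
    using C(1) by blast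
  ultimately have "{A. A \<subseteq> C \<and> antichain_in P A} \<subset> {A. A \<subseteq> E \<and> antichain_in P A}"
    by blast
  then show ?thesis unfolding num_antichains_def by (rule psubset_card_mono[OF fin])
qed

text \<open>A surjective map with unit steps is monotone, so it takes the value 0 at the bottom and
  1 at the top. What remains free is the set of interior points of value 1, an arbitrary up-set of
  the interior. Distinct extremes make the two forced values compatible.\<close>

lemma dedekind1_eq_num_antichains:
  assumes P: "ranked_poset P" and ne: "poset_bot P \<noteq> poset_top P"
  shows "dedekind1 P = num_antichains P (Field P - {poset_bot P, poset_top P})"
proof -
  note D = ranked_posetD[OF P] and B = poset_bot[OF P] and T = poset_top[OF P]
  let ?C = "Field P - {poset_bot P, poset_top P}"
  let ?F = "{f \<in> Field P \<rightarrow>\<^sub>E {0, 1::nat}. f ` Field P = {0, 1} \<and>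
             (\<forall>x y. covers P x y \<longrightarrow> f y \<in> {f x, f x + 1})}"
  define up where "up f = {x \<in> ?C. f x = 1}" for f :: "'a \<Rightarrow> nat"
  define ind where "ind U = (\<lambda>x\<in>Field P. if x \<in> U \<or> x = poset_top P then 1 else 0::nat)" for U
  have F: "f (poset_bot P) = 0 \<and> f (poset_top P) = 1 \<and> (\<forall>x y. (x, y) \<in> P \<longrightarrow> f x \<le> f y) \<and>
      (\<forall>x\<in>Field P. f x = 0 \<or> f x = 1)" if f: "f \<in> ?F" for f
  proof -
    have cov: "f y \<in> {f x, f x + 1}" if "covers P x y" for x y using f that by blast
    have m: "f x \<le> f y" if "(x, y) \<in> P" for x y
      using mono_if_unit_steps[OF P cov that] .
    have v: "f x = 0 \<or> f x = 1" if "x \<in> Field P" for x using f that by blast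
    have "0 \<in> f ` Field P" "1 \<in> f ` Field P" using f by auto
    then obtain x y where "x \<in> Field P" "f x = 0" "y \<in> Field P" "f y = 1" by auto
    then have "f (poset_bot P) \<le> 0" "1 \<le> f (poset_top P)" using m B T by metis+
    then show ?thesis using v[OF T(1)] m v by auto
  qed
  have "bij_betw up ?F (upsets_in P ?C)"
  proof (rule bij_betw_byWitness[where f' = ind])
    show "\<forall>f\<in>?F. ind (up f) = f"
    proof
      fix f assume f: "f \<in> ?F"
      then have "f \<in> extensional (Field P)" by (auto simp: PiE_def)
      then show "ind (up f) = f"
        using F[OF f] by (auto simp: ind_def up_def extensional_def fun_eq_iff)
    qed
    show "\<forall>U\<in>upsets_in P ?C. up (ind U) = U"
      by (auto simp: up_def ind_def upsets_in_def)
    show "up ` ?F \<subseteq> upsets_in P ?C"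
    proof (intro image_subsetI)
      fix f assume f: "f \<in> ?F"
      have "f y = 1" if "f x = 1" "(x, y) \<in> P" for x y
      proof -
        have "y \<in> Field P" "f x \<le> f y" using F[OF f] that D(2) by blast+
        then show ?thesis using F[OF f] that by fastforce
      qed
      then show "up f \<in> upsets_in P ?C" by (auto simp: up_def upsets_in_def)
    qed
    show "ind ` upsets_in P ?C \<subseteq> ?F"
    proof (intro image_subsetI)
      fix U assume U: "U \<in> upsets_in P ?C"
      have b: "ind U (poset_bot P) = 0" "ind U (poset_top P) = 1"
        using U B T ne by (auto simp: ind_def upsets_in_def)
      have r: "ind U \<in> Field P \<rightarrow>\<^sub>E {0, 1}" by (auto simp: ind_def)
      have "ind U ` Field P = {0, 1}"
      proof
        show "ind U ` Field P \<subseteq> {0, 1}" by (intro image_subsetI PiE_mem[OF r])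
        show "{0, 1} \<subseteq> ind U ` Field P"
          using b B(1) T(1) by (metis empty_subsetI imageI insert_subset)
      qed
      moreover have "ind U y \<in> {ind U x, ind U x + 1}" if "covers P x y" for x y
      proof -
        have xy: "(x, y) \<in> P" using that by (simp add: covers_def)
        then have "x \<in> Field P" "y \<in> Field P" using D by blast+
        moreover have "y \<in> U \<or> y = poset_top P" if "x \<in> U \<or> x = poset_top P"
        proof (cases "y = poset_top P")
          case False
          then have "x \<in> U" using that xy D(5) T(2) calculation by blast
          moreover from this have "x \<in> ?C" using U by (auto simp: upsets_in_def)
          then have "y \<noteq> poset_bot P" using xy D(5) B(2) by blast
          ultimately show ?thesis using U False xy \<open>y \<in> Field P\<close> by (auto simp: upsets_in_def)
        qed simp
        ultimately show ?thesis by (auto simp: ind_def)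
      qed
      ultimately show "ind U \<in> ?F" using r by blast
    qed
  qed
  then have "card ?F = card (upsets_in P ?C)" by (rule bij_betw_same_card)
  then show ?thesis
    unfolding dedekind1_def using num_antichains_eq_card_upsets[OF P, of ?C] by auto
qed

section \<open>Convex cut sets\<close>

definition convex_cut_sets :: "'a rel \<Rightarrow> 'a set set" where
  "convex_cut_sets P =
     {C. C \<subseteq> Field P - {poset_bot P, poset_top P} \<and> convex_in P C \<and> cut_set P C}"

text \<open>Rebuilds the top function of a quilt from its level set \<open>C\<close>. For a convex
  cut set, the default 0 is taken exactly strictly below \<open>C\<close>: a maximal chain through
  any point meets \<open>C\<close>, so every point outside \<open>C\<close> lies above or below an
  element of it.\<close>

definition height :: "'a rel \<Rightarrow> 'a set \<Rightarrow> 'a \<Rightarrow> nat" where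
  "height P C x = (if x \<in> C then 1 else if \<exists>c\<in>C. (c, x) \<in> P then 2 else 0)"

lemma convex_cut_setsD:
  assumes "C \<in> convex_cut_sets P"
  shows "C \<subseteq> Field P" "poset_bot P \<notin> C" "poset_top P \<notin> C"
    and "\<And>x y z. x \<in> C \<Longrightarrow> y \<in> C \<Longrightarrow> (x, z) \<in> P \<Longrightarrow> (z, y) \<in> P \<Longrightarrow> (x, y) \<in> P \<Longrightarrow> z \<in> C"
    and "\<And>M. maximal_chain P M \<Longrightarrow> \<exists>c\<in>C. c \<in> M"
  using assms unfolding convex_cut_sets_def convex_in_def cut_set_def by blast+

lemma height_bot:
  assumes P: "ranked_poset P" and C: "C \<in> convex_cut_sets P"
  shows "height P C (poset_bot P) = 0"
proof -
  have "(c, poset_bot P) \<notin> P" if "c \<in> C" for c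
    using that convex_cut_setsD(1,2)[OF C] poset_bot(2)[OF P] ranked_posetD(5)[OF P] by blast
  then show ?thesis using convex_cut_setsD(2)[OF C] by (auto simp: height_def)
qed

lemma height_top:
  assumes P: "ranked_poset P" and C: "C \<in> convex_cut_sets P"
  shows "height P C (poset_top P) = 2"
proof -
  \<comment> \<open>Extending the empty chain yields some maximal chain, which is enough to see that
    \<open>C\<close> is nonempty.\<close>
  obtain M where "maximal_chain P M"
    using chain_extends_to_maximal[OF P, of "{}"] by (auto simp: Chains_def)
  then obtain c where "c \<in> C" using convex_cut_setsD(5)[OF C] by blast
  then show ?thesis
    using convex_cut_setsD(1,3)[OF C] poset_top(2)[OF P] by (auto simp: height_def)
qed

lemma height_mono:
  assumes P: "ranked_poset P" and C: "C \<in> convex_cut_sets P" and xy: "(x, y) \<in> P"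
  shows "height P C x \<le> height P C y"
proof -
  note D = ranked_posetD[OF P]
  \<comment> \<open>Convexity rules out a descent from 2 to 1; descents to 0 are impossible by
    transitivity.\<close>
  have "y \<in> C \<Longrightarrow> c \<in> C \<Longrightarrow> (c, x) \<in> P \<Longrightarrow> x \<in> C" for c
    using convex_cut_setsD(4)[OF C, of c y x] xy D(4)[of c x y] by blast
  then show ?thesis using xy D(4) by (auto simp: height_def) blast+
qed

text \<open>By monotonicity only a jump from 0 to 2 has to be excluded. A maximal chain through
  \<open>x\<close> and \<open>y\<close> meets the cut set \<open>C\<close>, and the meeting point
  would lie strictly between them.\<close>

lemma height_covers:
  assumes P: "ranked_poset P" and C: "C \<in> convex_cut_sets P" and xy: "covers P x y"
  shows "height P C y \<in> {height P C x, height P C x + 1}"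
proof -
  note D = ranked_posetD[OF P]
  have le: "(x, y) \<in> P" using xy by (simp add: covers_def)
  have "\<not> (height P C x = 0 \<and> height P C y = 2)"
  proof
    assume h: "height P C x = 0 \<and> height P C y = 2"
    have "{x, y} \<in> Chains P" using le D by (auto simp: Chains_def)
    then obtain M where M: "maximal_chain P M" "{x, y} \<subseteq> M"
      using chain_extends_to_maximal[OF P] by blast
    then obtain c where c: "c \<in> C" "c \<in> M" using convex_cut_setsD(5)[OF C] by blast
    have cmp: "(c, x) \<in> P \<or> (x, c) \<in> P" "(c, y) \<in> P \<or> (y, c) \<in> P"
      using M c unfolding maximal_chain_def Chains_def by blast+
    have nx: "(c, x) \<notin> P" "c \<noteq> x" using h c by (auto simp: height_def split: if_splits)
    obtain d where d: "d \<in> C" "(d, y) \<in> P" "y \<notin> C"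
      using h by (auto simp: height_def split: if_splits)
    \<comment> \<open>Otherwise \<open>y\<close> would lie between \<open>d\<close> and
      \<open>c\<close>, both in \<open>C\<close>, and convexity would force \<open>y\<close> into
      \<open>C\<close>.\<close>
    have "(y, c) \<notin> P"
      using d c convex_cut_setsD(4)[OF C, of d c y] D(4)[of d y c] by blast
    then have "(x, c) \<in> P" "(c, y) \<in> P" using cmp nx by blast+
    then show False using xy nx d(3) c(1) unfolding covers_def by blast
  qed
  moreover have "height P C x \<le> height P C y" by (rule height_mono[OF P C le])
  moreover have "height P C x \<in> {0, 1, 2}" "height P C y \<in> {0, 1, 2}" by (auto simp: height_def)
  ultimately show ?thesis by auto
qed

text \<open>Convexity is monotonicity of \<open>h\<close>. For the cut property, take the last
  element of value 0 on a maximal chain: its cover in the chain has nonzero value, hence value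
  1.\<close>

lemma level_one_in_convex_cut_sets:
  assumes P: "ranked_poset P"
    and h: "h (poset_bot P) = 0" "h (poset_top P) = (2::nat)"
    and cov: "\<And>x y. covers P x y \<Longrightarrow> h y \<in> {h x, h x + 1}"
  shows "{x \<in> Field P. h x = 1} \<in> convex_cut_sets P"
proof -
  note D = ranked_posetD[OF P]
  let ?C = "{x \<in> Field P. h x = 1}"
  have m: "h x \<le> h y" if "(x, y) \<in> P" for x y
    using mono_if_unit_steps[OF P cov that] .
  have "convex_in P ?C"
  proof -
    have "z \<in> ?C" if "x \<in> ?C" "y \<in> ?C" "(x, z) \<in> P" "(z, y) \<in> P" for x y z
      using m[OF that(3)] m[OF that(4)] that D(2)[OF that(3)] by simp
    then show ?thesis unfolding convex_in_def by blast
  qed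
  moreover have "?C \<inter> M \<noteq> {}" if M: "maximal_chain P M" for M
  proof
    assume e: "?C \<inter> M = {}"
    have MF: "M \<subseteq> Field P" using M Chains_subset_Field by (auto simp: maximal_chain_def)
    have "poset_bot P \<in> M" using mem_maximal_chainI[OF P M] poset_bot[OF P] MF by blast
    then have "{x \<in> M. h x = 0} \<noteq> {}" using h by blast
    then obtain x where x: "x \<in> M" "h x = 0"
      and mx: "\<And>z. z \<in> M \<Longrightarrow> h z = 0 \<Longrightarrow> (x, z) \<in> P \<Longrightarrow> z = x"
      using maximal_element_exists[OF P, of "{x \<in> M. h x = 0}"] MF by blast
    then obtain y where y: "y \<in> M" "covers P x y"
      using maximal_chain_step[OF P M, of x] h by force
    then have "h y \<noteq> 0" using mx[of y] by (auto simp: covers_def)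
    then have "h y = 1" using cov[OF y(2)] x by auto
    then show False using e y MF by blast
  qed
  ultimately show ?thesis using h by (auto simp: convex_cut_sets_def cut_set_def)
qed

text \<open>So \<open>h\<close> can be recovered from its level set. Above the level set but off it,
  the value is at least 1, not 1 and at most 2. If \<open>x\<close> is not above the level set, a
  maximal chain through \<open>x\<close> meets the level set above \<open>x\<close>, which leaves
  only the value 0.\<close>

lemma height_level_one:
  assumes P: "ranked_poset P"
    and h: "h (poset_bot P) = 0" "h (poset_top P) = (2::nat)"
    and cov: "\<And>x y. covers P x y \<Longrightarrow> h y \<in> {h x, h x + 1}"
    and x: "x \<in> Field P"
  shows "height P {x \<in> Field P. h x = 1} x = h x"
proof -
  note D = ranked_posetD[OF P]
  let ?C = "{x \<in> Field P. h x = 1}"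
  have m: "h x \<le> h y" if "(x, y) \<in> P" for x y
    using mono_if_unit_steps[OF P cov that] .
  have h2: "h x \<le> 2" using m[of x "poset_top P"] x h poset_top[OF P] by auto
  consider "h x = 1" | "\<exists>c\<in>?C. (c, x) \<in> P" "h x \<noteq> 1" | "\<not> (\<exists>c\<in>?C. (c, x) \<in> P)" "h x \<noteq> 1"
    by blast
  then show ?thesis
  proof cases
    case 1
    then show ?thesis using x by (simp add: height_def)
  next
    case 2
    then obtain c where "h c = 1" "(c, x) \<in> P" by blast
    then have "h x = 2" using m[of c x] 2 h2 by simp
    then show ?thesis using 2 by (simp add: height_def)
  next
    case 3
    have "{x} \<in> Chains P" using x D(3) by (auto simp: Chains_def)
    then obtain M where M: "maximal_chain P M" "x \<in> M"
      using chain_extends_to_maximal[OF P] by blast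
    obtain c where c: "c \<in> ?C" "c \<in> M"
      using convex_cut_setsD(5)[OF level_one_in_convex_cut_sets[OF P h cov] M(1)] by blast
    then have "(x, c) \<in> P" using M 3 unfolding maximal_chain_def Chains_def by blast
    then have "h x = 0" using m[of x c] c 3 by simp
    then show ?thesis using 3 by (simp add: height_def)
  qed
qed

text \<open>If a maximal chain missed the interior, its first step from the bottom would reach the
  top, giving rank 1. Coinciding extremes would give rank 0.\<close>

lemma interior_in_convex_cut_sets:
  assumes P: "ranked_poset P" and r: "poset_rank P \<ge> 2"
  shows "poset_bot P \<noteq> poset_top P"
    and "Field P - {poset_bot P, poset_top P} \<in> convex_cut_sets P"
proof -
  note D = ranked_posetD[OF P] and B = poset_bot[OF P] and T = poset_top[OF P]
  let ?C = "Field P - {poset_bot P, poset_top P}"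
  \<comment> \<open>The same choice as in \<open>poset_rank\<close>, so that the assumed bound
    speaks of \<open>\<rho>\<close> at the top.\<close>
  define \<rho> where "\<rho> = (SOME \<rho>. rank_function P \<rho>)"
  have "rank_function P \<rho>" unfolding \<rho>_def using rank_function_exists[OF P] by (rule someI_ex)
  then have \<rho>: "\<rho> (poset_bot P) = 0" "\<And>x y. covers P x y \<Longrightarrow> \<rho> y = \<rho> x + 1"
    by (auto simp: rank_function_def)
  have top: "\<rho> (poset_top P) \<ge> 2" using r by (simp add: poset_rank_def \<rho>_def)
  show ne: "poset_bot P \<noteq> poset_top P" using top \<rho> by force
  have "convex_in P ?C"
    using D(2,5) B T by (auto simp: convex_in_def)
  moreover have "?C \<inter> M \<noteq> {}" if M: "maximal_chain P M" for M
  proof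
    assume e: "?C \<inter> M = {}"
    have MF: "M \<subseteq> Field P" using M Chains_subset_Field by (auto simp: maximal_chain_def)
    have "poset_bot P \<in> M" using mem_maximal_chainI[OF P M] B MF by blast
    then obtain y where y: "y \<in> M" "covers P (poset_bot P) y"
      using maximal_chain_step[OF P M _ ne] by blast
    then have "y = poset_top P" using e MF by (auto simp: covers_def)
    then show False using \<rho>(2)[OF y(2)] \<rho>(1) top by simp
  qed
  ultimately show "?C \<in> convex_cut_sets P" by (auto simp: convex_cut_sets_def cut_set_def)
qed

section \<open>Quilts\<close>

lemma covers_prod_order:
  assumes P: "Partial_order P" and Q: "Partial_order Q"
  shows "covers (prod_order P Q) (x, y) (x', y') \<longleftrightarrow>
    x = x' \<and> x \<in> Field P \<and> covers Q y y' \<or> covers P x x' \<and> y = y' \<and> y \<in> Field Q"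
    (is "?L \<longleftrightarrow> ?R")
proof
  have rP: "(u, u) \<in> P" if "u \<in> Field P" for u
    using P that by (auto simp: order_on_defs refl_on_def)
  have rQ: "(u, u) \<in> Q" if "u \<in> Field Q" for u
    using Q that by (auto simp: order_on_defs refl_on_def)
  have aP: "(u, v) \<in> P \<Longrightarrow> (v, u) \<in> P \<Longrightarrow> u = v" for u v
    using P by (auto simp: order_on_defs dest: antisymD)
  have aQ: "(u, v) \<in> Q \<Longrightarrow> (v, u) \<in> Q \<Longrightarrow> u = v" for u v
    using Q by (auto simp: order_on_defs dest: antisymD)
  {
    assume L: ?L
    then have le: "(x, x') \<in> P" "(y, y') \<in> Q" by (auto simp: covers_def prod_order_def)
    then have F: "x \<in> Field P" "x' \<in> Field P" "y \<in> Field Q" "y' \<in> Field Q"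
      by (auto intro: FieldI1 FieldI2)
    have btw: "(u, v) = (x, y) \<or> (u, v) = (x', y')"
      if "(x, u) \<in> P" "(u, x') \<in> P" "(y, v) \<in> Q" "(v, y') \<in> Q" for u v
      using L that by (auto simp: covers_def prod_order_def)
    have ne: "(x, y) \<noteq> (x', y')" using L by (auto simp: covers_def)
    show ?R
    proof (cases "x = x'")
      case True
      then show ?thesis using btw[of x] ne le F rP by (auto simp: covers_def)
    next
      case False
      \<comment> \<open>The corner \<open>(x, y')\<close> lies between the two pairs, so a cover
        cannot move both coordinates.\<close>
      then have "y = y'" using btw[of x y'] le F rP rQ by auto
      then show ?thesis using btw[of _ y] False le F rQ by (auto simp: covers_def)
    qed
  }
  assume ?R
  then show ?L
    using rP rQ aP aQ unfolding covers_def prod_order_def by auto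
qed

lemma Field_A2: "Field (A2 j) = {Bot, Top} \<union> Mid ` {..<j}"
  by (force simp: A2_def Let_def Field_def)

lemma mem_A2_iff:
  "(x, y) \<in> A2 j \<longleftrightarrow> x \<in> Field (A2 j) \<and> y \<in> Field (A2 j) \<and> (x = y \<or> x = Bot \<or> y = Top)"
  unfolding Field_A2 by (auto simp: A2_def Let_def)

lemma Partial_order_A2: "Partial_order (A2 j)"
  by (auto simp: order_on_defs refl_on_def trans_def antisym_def mem_A2_iff)

lemma poset_bot_A2: "poset_bot (A2 j) = Bot"
  unfolding poset_bot_def
  by (rule the_equality) (auto simp: least_element_def mem_A2_iff Field_A2)

lemma poset_top_A2: "poset_top (A2 j) = Top"
  unfolding poset_top_def
  by (rule the_equality) (auto simp: greatest_element_def mem_A2_iff Field_A2)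

text \<open>With \<open>j >= 1\<close> the element \<open>Mid 0\<close> exists and keeps
  \<open>Top\<close> from covering \<open>Bot\<close>.\<close>

lemma covers_A2:
  assumes "j \<ge> 1"
  shows "covers (A2 j) x y \<longleftrightarrow> (\<exists>i<j. x = Bot \<and> y = Mid i \<or> x = Mid i \<and> y = Top)"
proof
  assume L: "covers (A2 j) x y"
  have "\<not> (x = Bot \<and> y = Top)"
  proof
    assume "x = Bot \<and> y = Top"
    moreover have "(Bot, Mid 0) \<in> A2 j" "(Mid 0, Top) \<in> A2 j"
      using assms by (auto simp: mem_A2_iff Field_A2)
    ultimately show False using L by (auto simp: covers_def)
  qed
  then show "\<exists>i<j. x = Bot \<and> y = Mid i \<or> x = Mid i \<and> y = Top"
    using L by (auto simp: covers_def mem_A2_iff Field_A2)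
qed (auto simp: covers_def mem_A2_iff Field_A2)

lemma poset_rank_A2:
  assumes "j \<ge> 1"
  shows "poset_rank (A2 j) = 2"
proof -
  define \<rho> where "\<rho> = (SOME \<rho>. rank_function (A2 j) \<rho>)"
  \<comment> \<open>An explicit rank function validates the choice operator; the value at
    \<open>Top\<close> is then forced for the chosen one along \<open>Bot\<close>,
    \<open>Mid 0\<close>, \<open>Top\<close>.\<close>
  have "rank_function (A2 j) (case_A2_elem 0 (\<lambda>_. 1) 2)"
    using assms by (auto simp: rank_function_def poset_bot_A2 covers_A2)
  then have \<rho>: "rank_function (A2 j) \<rho>" unfolding \<rho>_def by (rule someI[of "rank_function (A2 j)"])
  have "covers (A2 j) Bot (Mid 0)" "covers (A2 j) (Mid 0) Top"
    using assms by (auto simp: covers_A2)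
  then have "\<rho> Top = 2" using \<rho> by (auto simp: rank_function_def poset_bot_A2)
  then show ?thesis by (simp add: poset_rank_def \<rho>_def poset_top_A2)
qed

text \<open>Splits a quilt into functions on \<open>P\<close>, one for each element of
  \<open>A2 j\<close>. As the level at \<open>Bot\<close> vanishes, the covers from
  \<open>Bot\<close> to \<open>Mid i\<close> turn into the bound \<open>{0, 1}\<close>; the corner
  value is 2 because \<open>P\<close> has rank at least 2.\<close>

lemma Quilts_A2_iff:
  assumes P: "ranked_poset P" and r: "poset_rank P \<ge> 2" and j: "j \<ge> 1"
  shows "f \<in> Quilts P (A2 j) \<longleftrightarrow>
    f \<in> extensional (Field P \<times> Field (A2 j)) \<and>
    (\<forall>x\<in>Field P. f (x, Bot) = 0) \<and>
    (\<forall>i<j. f (poset_bot P, Mid i) = 0) \<and> f (poset_bot P, Top) = 0 \<and>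
    f (poset_top P, Top) = 2 \<and>
    (\<forall>x\<in>Field P. \<forall>i<j. f (x, Mid i) \<in> {0, 1} \<and> f (x, Top) \<in> {f (x, Mid i), f (x, Mid i) + 1}) \<and>
    (\<forall>x y. covers P x y \<longrightarrow> f (y, Top) \<in> {f (x, Top), f (x, Top) + 1} \<and>
      (\<forall>i<j. f (y, Mid i) \<in> {f (x, Mid i), f (x, Mid i) + 1}))"
    (is "_ \<longleftrightarrow> ?R")
proof -
  have PP: "Partial_order P" using P by (simp add: ranked_poset_def)
  note c = covers_prod_order[OF PP Partial_order_A2, of j] covers_A2[OF j]
  have F: "x \<in> Field P \<and> y \<in> Field P" if "covers P x y" for x y
    using that by (auto simp: covers_def intro: FieldI1 FieldI2)
  have "(\<forall>p q. covers (prod_order P (A2 j)) p q \<longrightarrow> f q \<in> {f p, f p + 1}) \<longleftrightarrow>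
     (\<forall>x\<in>Field P. \<forall>i<j. f (x, Mid i) \<in> {f (x, Bot), f (x, Bot) + 1} \<and>
        f (x, Top) \<in> {f (x, Mid i), f (x, Mid i) + 1}) \<and>
     (\<forall>x y. covers P x y \<longrightarrow> f (y, Bot) \<in> {f (x, Bot), f (x, Bot) + 1} \<and>
       f (y, Top) \<in> {f (x, Top), f (x, Top) + 1} \<and>
      (\<forall>i<j. f (y, Mid i) \<in> {f (x, Mid i), f (x, Mid i) + 1}))"
    (is "?A \<longleftrightarrow> ?B")
  proof
    assume A: ?A
    have "f (x', y') \<in> {f (x, y), f (x, y) + 1}"
      if "x = x' \<and> x \<in> Field P \<and> covers (A2 j) y y' \<or> covers P x x' \<and> y = y' \<and> y \<in> Field (A2 j)"
      for x x' y y'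
      using A that c(1) by blast
    then show ?B unfolding c(2) Field_A2 by blast
  next
    assume B: ?B
    show ?A unfolding split_paired_All c Field_A2 using B by blast
  qed
  moreover have "f \<in> Field P \<times> Field (A2 j) \<rightarrow>\<^sub>E UNIV \<longleftrightarrow> f \<in> extensional (Field P \<times> Field (A2 j))"
    by (simp add: PiE_def)
  moreover have "min (poset_rank P) (poset_rank (A2 j)) = 2"
    using r poset_rank_A2[OF j] by simp
  moreover have "(\<forall>x\<in>Field P. \<forall>y\<in>Field (A2 j). x = poset_bot P \<or> y = Bot \<longrightarrow> f (x, y) = 0) \<longleftrightarrow>
    (\<forall>x\<in>Field P. f (x, Bot) = 0) \<and> (\<forall>i<j. f (poset_bot P, Mid i) = 0) \<and> f (poset_bot P, Top) = 0"
    using poset_bot(1)[OF P] unfolding Field_A2 by auto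
  ultimately have "f \<in> Quilts P (A2 j) \<longleftrightarrow>
    f \<in> extensional (Field P \<times> Field (A2 j)) \<and>
    ((\<forall>x\<in>Field P. f (x, Bot) = 0) \<and> (\<forall>i<j. f (poset_bot P, Mid i) = 0) \<and> f (poset_bot P, Top) = 0) \<and>
    f (poset_top P, Top) = 2 \<and> ?B"
    unfolding Quilts_def poset_bot_A2 poset_top_A2 by simp
  also have "\<dots> \<longleftrightarrow> ?R"
  proof (cases "\<forall>x\<in>Field P. f (x, Bot) = 0")
    case True
    then have e: "covers P x y \<Longrightarrow> f (x, Bot) = 0" "covers P x y \<Longrightarrow> f (y, Bot) = 0" for x y
      using F by blast+
    show ?thesis using True by (simp add: e cong: ball_cong imp_cong)
  qed blast
  finally show ?thesis .
qed

section \<open>Quilts as a convex cut set with \<open>j\<close> of its up-sets\<close>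

definition middle_data :: "'a rel \<Rightarrow> nat \<Rightarrow> ('a \<times> A2_elem \<Rightarrow> nat) \<Rightarrow> 'a set \<times> (nat \<Rightarrow> 'a set)" where
  "middle_data P j f =
     (let C = {x \<in> Field P. f (x, Top) = 1} in (C, \<lambda>i\<in>{..<j}. {x \<in> C. f (x, Mid i) = 1}))"

text \<open>The inverse of \<open>middle_data\<close>. Off \<open>C\<close> the middle values are
  forced: 1 where the height is 2, and 0 where it is 0.\<close>

definition quilt_of :: "'a rel \<Rightarrow> nat \<Rightarrow> 'a set \<times> (nat \<Rightarrow> 'a set) \<Rightarrow> 'a \<times> A2_elem \<Rightarrow> nat" where
  "quilt_of P j = (\<lambda>(C, U). \<lambda>(x, q)\<in>Field P \<times> Field (A2 j).
     case q of Bot \<Rightarrow> 0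
     | Mid i \<Rightarrow> if x \<in> U i \<or> height P C x = 2 then 1 else 0
     | Top \<Rightarrow> height P C x)"

lemma quilt_of_apply:
  assumes "x \<in> Field P"
  shows "quilt_of P j (C, U) (x, Bot) = 0"
    and "i < j \<Longrightarrow> quilt_of P j (C, U) (x, Mid i) = (if x \<in> U i \<or> height P C x = 2 then 1 else 0)"
    and "quilt_of P j (C, U) (x, Top) = height P C x"
  using assms by (auto simp: quilt_of_def Field_A2)

lemma middle_data_in:
  assumes P: "ranked_poset P" and r: "poset_rank P \<ge> 2" and j: "j \<ge> 1"
    and f: "f \<in> Quilts P (A2 j)"
  shows "middle_data P j f \<in> (SIGMA C:convex_cut_sets P. {..<j} \<rightarrow>\<^sub>E upsets_in P C)"
proof -
  note f' = f[unfolded Quilts_A2_iff[OF P r j]]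
  let ?C = "{x \<in> Field P. f (x, Top) = 1}"
  have "?C \<in> convex_cut_sets P"
    by (rule level_one_in_convex_cut_sets[OF P]) (use f' in blast)+
  moreover have "{x \<in> ?C. f (x, Mid i) = 1} \<in> upsets_in P ?C" if i: "i < j" for i
  proof -
    have "f (y, Mid i) = 1" if "(x, y) \<in> P" "f (x, Mid i) = 1" "y \<in> ?C" for x y
    proof -
      have "f (x, Mid i) \<le> f (y, Mid i)"
        by (rule mono_if_unit_steps[OF P _ that(1)]) (use f' i in blast)
      moreover have "f (y, Mid i) \<in> {0, 1}" using f' i that(3) by blast
      ultimately show ?thesis using that by auto
    qed
    then show ?thesis by (auto simp: upsets_in_def)
  qed
  ultimately show ?thesis by (auto simp: middle_data_def Let_def)
qed

lemma quilt_of_in_Quilts: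
  assumes P: "ranked_poset P" and r: "poset_rank P \<ge> 2" and j: "j \<ge> 1"
    and C: "C \<in> convex_cut_sets P" and U: "U \<in> {..<j} \<rightarrow>\<^sub>E upsets_in P C"
  shows "quilt_of P j (C, U) \<in> Quilts P (A2 j)"
  unfolding Quilts_A2_iff[OF P r j]
proof (intro conjI ballI allI impI)
  have U1: "U i \<subseteq> C" if "i < j" for i using U that by (fastforce simp: upsets_in_def)
  have hC: "height P C x = 1 \<longleftrightarrow> x \<in> C" for x by (auto simp: height_def)
  have h3: "height P C x = 0 \<or> height P C x = 1 \<or> height P C x = 2" for x by (auto simp: height_def)
  show "quilt_of P j (C, U) \<in> extensional (Field P \<times> Field (A2 j))"
    by (auto simp: quilt_of_def)
  show "quilt_of P j (C, U) (x, Bot) = 0" if "x \<in> Field P" for x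
    using that by (simp add: quilt_of_apply)
  show "quilt_of P j (C, U) (poset_bot P, Top) = 0"
    using poset_bot(1)[OF P] height_bot[OF P C] by (simp add: quilt_of_apply)
  show "quilt_of P j (C, U) (poset_top P, Top) = 2"
    using poset_top(1)[OF P] height_top[OF P C] by (simp add: quilt_of_apply)
  show "quilt_of P j (C, U) (poset_bot P, Mid i) = 0" if "i < j" for i
    using that poset_bot(1)[OF P] height_bot[OF P C] U1[OF that] convex_cut_setsD(2)[OF C]
    by (auto simp: quilt_of_apply)
  fix x i assume x: "x \<in> Field P" and i: "i < j"
  show "quilt_of P j (C, U) (x, Mid i) \<in> {0, 1}"
    using x i by (simp add: quilt_of_apply)
  \<comment> \<open>Height 1 is compatible with both middle values; at height 0 the middle value is
    0 because \<open>U i\<close> stays inside \<open>C\<close>.\<close>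
  show "quilt_of P j (C, U) (x, Top) \<in>
      {quilt_of P j (C, U) (x, Mid i), quilt_of P j (C, U) (x, Mid i) + 1}"
    using x i h3[of x] hC[of x] U1[OF i] by (auto simp: quilt_of_apply)
next
  note D = ranked_posetD[OF P]
  have U1: "U i \<subseteq> C" if "i < j" for i using U that by (fastforce simp: upsets_in_def)
  have U2: "y \<in> U i" if "i < j" "x \<in> U i" "(x, y) \<in> P" "y \<in> C" for i x y
    using U that by (fastforce simp: upsets_in_def)
  fix x y assume c: "covers P x y"
  then have le: "(x, y) \<in> P" by (simp add: covers_def)
  then have F: "x \<in> Field P" "y \<in> Field P" using D by blast+
  note h = height_covers[OF P C c]
  show "quilt_of P j (C, U) (y, Top) \<in>
      {quilt_of P j (C, U) (x, Top), quilt_of P j (C, U) (x, Top) + 1}"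
    using h F by (simp add: quilt_of_apply)
  fix i assume i: "i < j"
  have h3: "height P C y = 0 \<or> height P C y = 1 \<or> height P C y = 2" by (auto simp: height_def)
  have hC: "height P C z = 1 \<longleftrightarrow> z \<in> C" for z by (auto simp: height_def)
  \<comment> \<open>Height 2 persists upward. From a point of \<open>U i\<close>, of height 1, the
    cover either stays in \<open>C\<close>, hence in the up-set \<open>U i\<close>, or reaches
    height 2.\<close>
  have "y \<in> U i \<or> height P C y = 2" if "x \<in> U i \<or> height P C x = 2"
    using that h h3 hC[of x] hC[of y] U1[OF i] U2[OF i _ le] by auto
  then show "quilt_of P j (C, U) (y, Mid i) \<in>
      {quilt_of P j (C, U) (x, Mid i), quilt_of P j (C, U) (x, Mid i) + 1}"
    using F i by (auto simp: quilt_of_apply)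
qed

lemma bij_betw_middle_data:
  assumes P: "ranked_poset P" and r: "poset_rank P \<ge> 2" and j: "j \<ge> 1"
  shows "bij_betw (middle_data P j) (Quilts P (A2 j))
    (SIGMA C:convex_cut_sets P. {..<j} \<rightarrow>\<^sub>E upsets_in P C)"
proof (rule bij_betw_byWitness[where f' = "quilt_of P j"])
  show "middle_data P j ` Quilts P (A2 j) \<subseteq> (SIGMA C:convex_cut_sets P. {..<j} \<rightarrow>\<^sub>E upsets_in P C)"
    using middle_data_in[OF P r j] by blast
  show "quilt_of P j ` (SIGMA C:convex_cut_sets P. {..<j} \<rightarrow>\<^sub>E upsets_in P C) \<subseteq> Quilts P (A2 j)"
    using quilt_of_in_Quilts[OF P r j] by auto
  show "\<forall>f\<in>Quilts P (A2 j). quilt_of P j (middle_data P j f) = f"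
  proof
    fix f assume "f \<in> Quilts P (A2 j)"
    note f = this[unfolded Quilts_A2_iff[OF P r j]]
    let ?C = "{x \<in> Field P. f (x, Top) = 1}"
    let ?U = "\<lambda>i\<in>{..<j}. {x \<in> ?C. f (x, Mid i) = 1}"
    have h: "height P ?C x = f (x, Top)" if "x \<in> Field P" for x
      by (rule height_level_one[OF P _ _ _ that]) (use f in blast)+
    have "quilt_of P j (?C, ?U) (x, q) = f (x, q)" for x q
    proof (cases "x \<in> Field P \<and> q \<in> Field (A2 j)")
      case True
      then show ?thesis
      proof (cases q)
        case (Mid i)
        then have i: "i < j" using True by (auto simp: Field_A2)
        \<comment> \<open>Top value 0 forces middle value 0 and top value 2 forces 1, so only points
          of \<open>?C\<close> carry information in \<open>?U\<close>.\<close>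
        have "f (x, Mid i) \<in> {0, 1} \<and> f (x, Top) \<in> {f (x, Mid i), f (x, Mid i) + 1}"
          using f True i by blast
        then show ?thesis using True i h[of x] by (auto simp: Mid quilt_of_apply)
      qed (use f h in \<open>auto simp: quilt_of_apply\<close>)
    next
      case False
      then have "f (x, q) = undefined" using f by (auto simp: extensional_def)
      moreover have "quilt_of P j (?C, ?U) (x, q) = undefined"
        using False by (auto simp: quilt_of_def)
      ultimately show ?thesis by simp
    qed
    then show "quilt_of P j (middle_data P j f) = f"
      by (auto simp: middle_data_def Let_def)
  qed
  show "\<forall>D\<in>(SIGMA C:convex_cut_sets P. {..<j} \<rightarrow>\<^sub>E upsets_in P C).
      middle_data P j (quilt_of P j D) = D"
  proof safe
    fix C U assume C: "C \<in> convex_cut_sets P" and U: "U \<in> {..<j} \<rightarrow>\<^sub>E upsets_in P C"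
    have CF: "C \<subseteq> Field P" by (rule convex_cut_setsD(1)[OF C])
    have eC: "{x \<in> Field P. quilt_of P j (C, U) (x, Top) = 1} = C"
      using CF by (auto simp: quilt_of_apply height_def split: if_splits)
    \<comment> \<open>On \<open>C\<close> the height is 1, so the clause for height 2 in
      \<open>quilt_of\<close> never applies there.\<close>
    have "{x \<in> C. quilt_of P j (C, U) (x, Mid i) = 1} = U i" if "i < j" for i
    proof -
      have "U i \<subseteq> C" using U that by (fastforce simp: upsets_in_def)
      then show ?thesis using CF that by (auto simp: quilt_of_apply height_def subset_iff split: if_splits)
    qed
    then have "(\<lambda>i\<in>{..<j}. {x \<in> C. quilt_of P j (C, U) (x, Mid i) = 1}) = U"
      using U by (auto simp: fun_eq_iff PiE_def extensional_def)
    then show "middle_data P j (quilt_of P j (C, U)) = (C, U)"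
      unfolding middle_data_def Let_def eC by simp
  qed
qed

section \<open>The counting formula and its asymptotics\<close>

lemma finite_convex_cut_sets:
  assumes "ranked_poset P"
  shows "finite (convex_cut_sets P)"
  by (rule finite_subset[of _ "Pow (Field P)"])
    (use ranked_posetD(6)[OF assms] in \<open>auto simp: convex_cut_sets_def\<close>)

lemma card_Quilts_A2:
  assumes P: "ranked_poset P" and r: "poset_rank P \<ge> 2" and j: "j \<ge> 1"
  shows "card (Quilts P (A2 j)) = (\<Sum>C\<in>convex_cut_sets P. num_antichains P C ^ j)"
proof -
  have CF: "C \<subseteq> Field P" if "C \<in> convex_cut_sets P" for C
    using that by (rule convex_cut_setsD(1))
  have "finite (upsets_in P C)" if "C \<in> convex_cut_sets P" for C
    by (rule finite_subset[of _ "Pow (Field P)"])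
      (use CF[OF that] ranked_posetD(6)[OF P] in \<open>auto simp: upsets_in_def\<close>)
  then have "card (Quilts P (A2 j)) = (\<Sum>C\<in>convex_cut_sets P. card (upsets_in P C) ^ j)"
    unfolding bij_betw_same_card[OF bij_betw_middle_data[OF P r j]]
    by (subst card_SigmaI) (auto simp: finite_convex_cut_sets[OF P] card_PiE intro!: finite_PiE)
  then show ?thesis
    using CF num_antichains_eq_card_upsets[OF P] by simp
qed

text \<open>After division by \<open>a m ^ j\<close> the summand of \<open>m\<close> is constantly
  1, and each of the finitely many others is a power of a ratio in [0, 1), tending to 0.\<close>

lemma sum_powers_asymp_equiv_dominant:
  fixes a :: "'a \<Rightarrow> real"
  assumes S: "finite S" "m \<in> S" and a: "\<And>s. s \<in> S \<Longrightarrow> a s \<ge> 0"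
    and lt: "\<And>s. s \<in> S \<Longrightarrow> s \<noteq> m \<Longrightarrow> a s < a m" and m: "a m > 0"
  shows "(\<lambda>j. \<Sum>s\<in>S. a s ^ j) \<sim>[at_top] (\<lambda>j. a m ^ j)"
proof (rule asymp_equivI')
  have "(\<lambda>j. (a s / a m) ^ j) \<longlonglongrightarrow> (if s = m then 1 else 0)" if "s \<in> S" for s
    using a[OF that] lt[OF that] m by (auto intro!: LIMSEQ_realpow_zero)
  then have "(\<lambda>j. \<Sum>s\<in>S. (a s / a m) ^ j) \<longlonglongrightarrow> (\<Sum>s\<in>S. if s = m then 1 else 0)"
    by (rule tendsto_sum)
  then show "(\<lambda>j. (\<Sum>s\<in>S. a s ^ j) / a m ^ j) \<longlonglongrightarrow> 1"
    using S by (simp add: sum_divide_distrib power_divide)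
qed

theorem theorem6p1:
  fixes P :: "'a rel"
  assumes "ranked_poset P" and "poset_rank P \<ge> 2"
  shows "(\<forall>j\<ge>1. card (Quilts P (A2 j)) =
            (\<Sum>C | C \<subseteq> Field P - {poset_bot P, poset_top P} \<and> convex_in P C \<and> cut_set P C.
               num_antichains P C ^ j)) \<and>
         (\<lambda>j. real (card (Quilts P (A2 j)))) \<sim>[at_top] (\<lambda>j. real (dedekind1 P) ^ j)"
proof
  show "\<forall>j\<ge>1. card (Quilts P (A2 j)) =
            (\<Sum>C | C \<subseteq> Field P - {poset_bot P, poset_top P} \<and> convex_in P C \<and> cut_set P C.
               num_antichains P C ^ j)"
    using card_Quilts_A2[OF assms] by (simp add: convex_cut_sets_def)
  let ?E = "Field P - {poset_bot P, poset_top P}"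
  note E = interior_in_convex_cut_sets[OF assms]
  have lt: "num_antichains P C < num_antichains P ?E" if "C \<in> convex_cut_sets P" "C \<noteq> ?E" for C
    using that by (intro num_antichains_strict_mono[OF assms(1)]) (auto simp: convex_cut_sets_def)
  have "finite {A. A \<subseteq> ?E \<and> antichain_in P A}"
    using ranked_posetD(6)[OF assms(1)] by simp
  \<comment> \<open>The empty antichain is always counted.\<close>
  then have pos: "num_antichains P ?E > 0"
    unfolding num_antichains_def card_gt_0_iff by (auto simp: antichain_in_def)
  have "(\<lambda>j. \<Sum>C\<in>convex_cut_sets P. real (num_antichains P C) ^ j)
      \<sim>[at_top] (\<lambda>j. real (num_antichains P ?E) ^ j)"
    using E(2) lt pos finite_convex_cut_sets[OF assms(1)]
    by (intro sum_powers_asymp_equiv_dominant) auto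
  \<comment> \<open>The counting formula is stated for \<open>j >= 1\<close>, so the two sequences
    are identified only eventually.\<close>
  moreover have "eventually (\<lambda>j. (\<Sum>C\<in>convex_cut_sets P. real (num_antichains P C) ^ j) =
      real (card (Quilts P (A2 j)))) at_top"
    using eventually_ge_at_top[of 1] by eventually_elim (simp add: card_Quilts_A2[OF assms])
  ultimately show "(\<lambda>j. real (card (Quilts P (A2 j)))) \<sim>[at_top] (\<lambda>j. real (dedekind1 P) ^ j)"
    unfolding dedekind1_eq_num_antichains[OF assms(1) E(1)]
    by (rule asymp_equiv_transfer) simp
qed

end
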